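(* For every integer $n\geq 2$, $$ \Upsilon(n)<(n-1)\log\log(n-1)+c_4(n-1)+\frac{n}{\log n}+\frac{1717433\, n}{\log^5 n}. $$
   Context: Here $\log$ is the natural logarithm and $\log^k x$ means $(\log x)^k$. For a positive integer $n$ and a prime $p$, $v_p(n!)$ denotes the exponent of $p$ in the prime factorization of $n!$, and $$\Upsilon(n)=\sum_{p\leq n}v_p(n!),$$ the sum being over primes $p\le n$. The exponential integral is $\mathrm{Ei}(a,z)=\int_1^\infty e^{-tz}t^{-a}\,dt$ for $\Re(z)>0$. The constant $c_4$ is effective; it is $c_4=c_1+c_3\approx 21.18095291$, where $$c_1=\frac{-5937\log^2 2+3965\log 2+1586}{600\log^3 2}\approx 7.416262921,$$ $$c_2=\int_2^{e+1}\frac{1200x^3+365x^2+9944x-1993}{1200(x-1)^4\log x}\,dx\approx 12.35466367,$$ $$c_3=\frac{793}{240}\mathrm{Ei}(1,1)+\frac{2379}{200}\mathrm{Ei}(1,2)+\frac{793}{100}\mathrm{Ei}(1,3)+c_2\approx 13.76468999.$$ *)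

theory Defs
  imports "HOL-Analysis.Analysis" "HOL-Computational_Algebra.Primes"
begin

text \<open>The bound is claimed from \<open>n = 2\<close> on, where \<open>log (log (n - 1))\<close> is \<open>log 0\<close>; HOL's convention
  \<open>ln 0 = 0\<close> makes that term vanish. For \<open>n \<ge> 3\<close> all terms have their usual meaning.\<close>

definition Upsilon :: "nat \<Rightarrow> nat" where
  "Upsilon n = (\<Sum>p | prime p \<and> p \<le> n. multiplicity p (fact n :: nat))"

text \<open>The generalised exponential integral, meaningful for \<open>Re z > 0\<close>.\<close>

definition Ei :: "complex \<Rightarrow> complex \<Rightarrow> complex" where
  "Ei a z = integral {1..} (\<lambda>t::real. exp (- (of_real t * z)) * of_real t powr (- a))"

definition c\<^sub>1 :: real where
  "c\<^sub>1 = (- 5937 * (ln 2)^2 + 3965 * ln 2 + 1586) / (600 * (ln 2)^3)"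

definition c\<^sub>2 :: real where
  "c\<^sub>2 = integral {2..exp 1 + 1}
     (\<lambda>x::real. (1200 * x^3 + 365 * x^2 + 9944 * x - 1993) / (1200 * (x - 1)^4 * ln x))"

text \<open>The values \<open>Ei 1 1\<close>, \<open>Ei 1 2\<close>, \<open>Ei 1 3\<close> are real, so taking \<open>Re\<close> only changes the type.\<close>

definition c\<^sub>3 :: real where
  "c\<^sub>3 = 793/240 * Re (Ei 1 1) + 2379/200 * Re (Ei 1 2) + 793/100 * Re (Ei 1 3) + c\<^sub>2"

definition c\<^sub>4 :: real where
  "c\<^sub>4 = c\<^sub>1 + c\<^sub>3"

end

theory Submission
  imports Defs
begin

text \<open>
  By Legendre's formula, \<open>v\<^sub>p(n!)\<close> is at most \<open>(n - 1) / (p - 1)\<close>, so \<open>\<Upsilon>(n)\<close> is at most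
  \<open>(n - 1)\<close> times the sum of \<open>1 / (p - 1)\<close> over the primes \<open>p \<le> n\<close>. By Mertens' second theorem
  that sum is \<open>ln (ln n) + O(1)\<close>, and the constant \<open>c\<^sub>4 \<approx> 21.18\<close> is so generous that the crudest
  explicit version suffices: \<open>ln (ln n) + 5\<close> (lemma \<open>sum_inverse_pred_primes_le\<close>).

  The upper half of Mertens' theorems needs only two ingredients. Chebyshev's
  \<open>\<Sum>\<^sub>p\<^sub>\<le>\<^sub>n ln p \<le> n ln 4\<close> (\<open>sum_ln_primes_le\<close>) measures the loss in replacing \<open>\<lfloor>n / p\<rfloor>\<close> by \<open>n / p\<close>
  in \<open>\<Sum>\<^sub>p\<^sub>\<le>\<^sub>n \<lfloor>n / p\<rfloor> ln p \<le> ln n! \<le> n ln n\<close>; this gives \<open>\<Sum>\<^sub>p\<^sub>\<le>\<^sub>n ln p / p \<le> ln n + ln 4\<close>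
  (\<open>sum_ln_over_primes_le\<close>). Abel summation against the weight \<open>1 / ln\<close> then turns this into a bound
  for \<open>\<Sum>\<^sub>p\<^sub>\<le>\<^sub>n 1 / p\<close>.

  Passing from \<open>ln (ln n)\<close> to \<open>ln (ln (n - 1))\<close> costs at most \<open>1\<close>, so it remains to see that
  \<open>c\<^sub>4 \<ge> 6\<close>. Already \<open>c\<^sub>1 \<ge> 6\<close>, while \<open>c\<^sub>2\<close> and the values of the exponential integral are nonnegative,
  being integrals of nonnegative functions. The two positive terms \<open>n / ln n\<close> and \<open>1717433 n / ln\<^sup>5 n\<close>
  make the inequality strict.
\<close>

section \<open>Multiplicities of primes in factorials\<close>

lemma multiplicity_fact_Suc:
  fixes p n :: nat
  assumes "prime p"
  shows "multiplicity p (fact (Suc n) :: nat) = multiplicity p (Suc n) + multiplicity p (fact n :: nat)"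
proof -
  have "(fact (Suc n) :: nat) = Suc n * fact n" by simp
  then show ?thesis
    using assms by (simp only:) (rule prime_elem_multiplicity_mult_distrib, auto)
qed

text \<open>Legendre's formula in recursive form: the \<open>n div p\<close> multiples of \<open>p\<close> up to \<open>n\<close> contribute one
  factor \<open>p\<close> each, and dividing them all by \<open>p\<close> leaves the numbers \<open>1, \<dots>, n div p\<close>. In the induction on
  \<open>n\<close> both sides change only when \<open>p\<close> divides \<open>Suc n\<close>.\<close>

lemma multiplicity_fact_rec:
  fixes p n :: nat
  assumes "prime p"
  shows "multiplicity p (fact n :: nat) = n div p + multiplicity p (fact (n div p) :: nat)"
proof (induction n)
  case 0
  then show ?case by simp
next
  case (Suc n)
  have p: "p > 1" using assms by (auto dest: prime_gt_1_nat)
  show ?case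
  proof (cases "p dvd Suc n")
    case True
    then obtain m where m: "Suc n = p * m" by blast
    then obtain k where k: "m = Suc k" by (cases m) auto
    have d1: "Suc n div p = Suc k" using m k p by simp
    have d2: "n div p = k" using d1 True p by (simp add: div_Suc dvd_eq_mod_eq_0)
    have "multiplicity p (Suc n) = Suc (multiplicity p m)"
      unfolding m using p k by (intro multiplicity_times_same) auto
    then show ?thesis
      using Suc.IH multiplicity_fact_Suc[OF assms, of n] multiplicity_fact_Suc[OF assms, of k]
      unfolding d1 d2 k by linarith
  next
    case False
    then have "Suc n div p = n div p" by (auto simp: div_Suc dvd_eq_mod_eq_0)
    moreover have "multiplicity p (Suc n) = 0" using False by (rule not_dvd_imp_multiplicity_0)
    ultimately show ?thesis using Suc.IH multiplicity_fact_Suc[OF assms, of n] by simp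
  qed
qed

text \<open>Iterating the recursion sums a geometric series of ratio \<open>1 / p\<close>. The saving of \<open>1\<close> on the right
  comes from the last nonzero quotient; it is what produces the factor \<open>n - 1\<close> in place of \<open>n\<close>.\<close>

lemma multiplicity_fact_upper:
  fixes p n :: nat
  assumes "prime p" "n > 0"
  shows "(p - 1) * multiplicity p (fact n :: nat) \<le> n - 1"
  using assms(2)
proof (induction n rule: less_induct)
  case (less n)
  have p: "p > 1" using assms by (auto dest: prime_gt_1_nat)
  define q where "q = n div p"
  have rec: "multiplicity p (fact n :: nat) = q + multiplicity p (fact q :: nat)"
    unfolding q_def by (rule multiplicity_fact_rec[OF assms(1)])
  show ?case
  proof (cases "q = 0")
    case True
    then show ?thesis using rec by simp
  next
    case False
    have "q < n" unfolding q_def using p less.prems by simp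
    with False less.IH have IH: "(p - 1) * multiplicity p (fact q :: nat) \<le> q - 1" by simp
    have "(p - 1) * multiplicity p (fact n :: nat) \<le> (p - 1) * q + (q - 1)"
      unfolding rec using IH by (simp add: add_mult_distrib2)
    also have "\<dots> = p * q - 1" using p False
      by (cases p; cases q) (auto simp: algebra_simps)
    also have "\<dots> \<le> n - 1" unfolding q_def by (simp add: diff_le_mono)
    finally show ?thesis .
  qed
qed

section \<open>Chebyshev's bound for the product of primes\<close>

lemma prod_primes_dvd:
  fixes N :: nat
  assumes "finite A" "\<And>p. p \<in> A \<Longrightarrow> prime p" "\<And>p. p \<in> A \<Longrightarrow> p dvd N"
  shows "\<Prod>A dvd N"
  using assms
proof (induction A rule: finite_induct)
  case empty
  then show ?case by simp
next
  case (insert p A)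
  have "coprime p (\<Prod>A)"
    using insert by (intro prod_coprime_right primes_coprime) auto
  then show ?case using insert by (auto intro!: divides_mult)
qed

text \<open>Row \<open>2 * m + 1\<close> of Pascal's triangle has sum \<open>2 * 4 ^ m\<close> and contains this coefficient twice.\<close>

lemma binomial_middle_odd_le: "(2 * m + 1 choose m) \<le> 4 ^ m"
proof -
  have "(2 * m + 1 choose m) + (2 * m + 1 choose Suc m) = (\<Sum>k\<in>{m, Suc m}. 2 * m + 1 choose k)"
    by simp
  also have "\<dots> \<le> (\<Sum>k\<le>2 * m + 1. 2 * m + 1 choose k)"
    by (intro sum_mono2) auto
  also have "\<dots> = 2 * 4 ^ m"
    unfolding choose_row_sum by (simp add: power_mult)
  finally show ?thesis
    using binomial_symmetric[of m "2 * m + 1"] by simp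
qed

text \<open>The primes between \<open>m + 2\<close> and \<open>2 * m + 1\<close> divide \<open>(2 * m + 1)!\<close> but neither \<open>m!\<close> nor \<open>(m + 1)!\<close>, so
  they all divide the middle binomial coefficient and their product is at most \<open>4 ^ m\<close>. The primes up to \<open>m + 1\<close>
  are left to the induction hypothesis, and an even \<open>n > 2\<close> adds no prime.\<close>

lemma prod_primes_le: "\<Prod>{p. prime p \<and> p \<le> n} \<le> (4::nat) ^ n"
proof (induction n rule: less_induct)
  case (less n)
  consider "n \<le> 1" | "n = 2" | "n > 2" "even n" | m where "n = 2 * m + 1" "m > 0"
    by (cases "even n"; cases "n \<le> 2") (force elim!: oddE)+
  then show ?case
  proof cases
    case 1
    then have "{p. prime p \<and> p \<le> n} = {}" by (auto dest: prime_ge_2_nat)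
    then show ?thesis by (simp only: prod.empty) simp
  next
    case 2
    then have "{p. prime p \<and> p \<le> n} = {2}" by (auto dest: prime_ge_2_nat)
    then show ?thesis using 2 by simp
  next
    case 3
    then have "\<not> prime n" using prime_odd_nat by blast
    then have "{p. prime p \<and> p \<le> n} = {p. prime p \<and> p \<le> n - 1}"
      by (auto simp: le_less)
    moreover have "(4::nat) ^ (n - 1) \<le> 4 ^ n" by (intro power_increasing) auto
    moreover have "\<Prod>{p. prime p \<and> p \<le> n - 1} \<le> 4 ^ (n - 1)" using less.IH[of "n - 1"] 3 by simp
    ultimately show ?thesis by (metis le_trans)
  next
    case 4
    let ?A = "{p. prime p \<and> p \<le> m + 1}" and ?B = "{p. prime p \<and> m + 1 < p \<and> p \<le> n}"
    have "{p. prime p \<and> p \<le> n} = ?A \<union> ?B" using 4 by auto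
    then have "\<Prod>{p. prime p \<and> p \<le> n} = \<Prod>?A * \<Prod>?B"
      by (simp only:) (intro prod.union_disjoint, auto)
    moreover have "\<Prod>?A \<le> 4 ^ (m + 1)" using less.IH[of "m + 1"] 4 by simp
    moreover have "\<Prod>?B dvd (n choose m)"
    proof (rule prod_primes_dvd)
      fix p assume "p \<in> ?B"
      then have p: "prime p" "m + 1 < p" "p \<le> n" by auto
      have "fact m * fact (n - m) * (n choose m) = (fact n :: nat)"
        using 4 by (intro binomial_fact_lemma) auto
      moreover have "p dvd (fact n :: nat)" "\<not> p dvd (fact m :: nat)" "\<not> p dvd (fact (n - m) :: nat)"
        using p 4 by (simp_all add: prime_dvd_fact_iff del: fact_Suc)
      ultimately show "p dvd (n choose m)"
        using p(1) by (metis prime_dvd_mult_iff)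
    qed auto
    then have "\<Prod>?B \<le> (n choose m)" using 4 by (intro dvd_imp_le) auto
    then have "\<Prod>?B \<le> 4 ^ m" using binomial_middle_odd_le[of m] 4 by simp
    ultimately have "\<Prod>{p. prime p \<and> p \<le> n} \<le> 4 ^ (m + 1) * 4 ^ m"
      by (simp only:) (intro mult_mono, auto)
    also have "\<dots> = 4 ^ n" using 4 by (simp add: power_add[symmetric] mult_2)
    finally show ?thesis .
  qed
qed

lemma sum_ln_primes_le: "(\<Sum>p | prime p \<and> p \<le> n. ln (real p)) \<le> real n * ln 4"
proof -
  have "(\<Sum>p | prime p \<and> p \<le> n. ln (real p)) = ln (\<Prod>p | prime p \<and> p \<le> n. real p)"
    by (subst ln_prod) (auto simp: prime_gt_0_nat)
  also have "\<dots> \<le> ln (4 ^ n)"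
  proof (rule ln_mono)
    show "0 < (\<Prod>p | prime p \<and> p \<le> n. real p)"
      by (intro prod_pos) (auto simp: prime_gt_0_nat)
    have "real (\<Prod>{p. prime p \<and> p \<le> n}) \<le> real (4 ^ n)"
      using prod_primes_le[of n] by (intro of_nat_mono)
    then show "(\<Prod>p | prime p \<and> p \<le> n. real p) \<le> 4 ^ n"
      by (simp add: of_nat_prod)
  qed
  finally show ?thesis by (simp add: ln_realpow)
qed

section \<open>Mertens' upper bounds\<close>

lemma ln_fact_eq_sum_multiplicity:
  "ln (fact n) = (\<Sum>p | prime p \<and> p \<le> n. real (multiplicity p (fact n :: nat)) * ln (real p))"
proof -
  have eq: "prime_factors (fact n :: nat) = {p. prime p \<and> p \<le> n}"
    unfolding prime_factors_fact by (auto dest: prime_ge_2_nat)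
  have "(fact n :: real) = real (fact n)" by simp
  also have "(fact n :: nat) = (\<Prod>p\<in>prime_factors (fact n :: nat). p ^ multiplicity p (fact n :: nat))"
    by (rule prime_factorization_nat) simp
  finally have "(fact n :: real) = (\<Prod>p | prime p \<and> p \<le> n. real p ^ multiplicity p (fact n :: nat))"
    unfolding eq by (simp add: of_nat_prod)
  then have "ln (fact n) = ln (\<Prod>p | prime p \<and> p \<le> n. real p ^ multiplicity p (fact n :: nat))"
    by simp
  also have "\<dots> = (\<Sum>p | prime p \<and> p \<le> n. ln (real p ^ multiplicity p (fact n :: nat)))"
    by (subst ln_prod) (auto simp: prime_gt_0_nat)
  also have "\<dots> = (\<Sum>p | prime p \<and> p \<le> n. real (multiplicity p (fact n :: nat)) * ln (real p))"
    by (intro sum.cong) (auto simp: ln_realpow prime_gt_0_nat)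
  finally show ?thesis .
qed

text \<open>Mertens' first theorem, upper half, obtained by comparing \<open>n! \<le> n ^ n\<close> with the prime factorisation of \<open>n!\<close>:
  each prime \<open>p \<le> n\<close> has multiplicity at least \<open>n div p > n / p - 1\<close>, and Chebyshev's bound controls
  the total contribution of the \<open>- 1\<close>.\<close>

lemma sum_ln_over_primes_le:
  assumes "n > 0"
  shows "(\<Sum>p | prime p \<and> p \<le> n. ln (real p) / real p) \<le> ln (real n) + ln 4"
proof -
  let ?P = "{p. prime p \<and> p \<le> n}"
  have "real n * (\<Sum>p\<in>?P. ln (real p) / real p) - (\<Sum>p\<in>?P. ln (real p))
      = (\<Sum>p\<in>?P. (real n / real p - 1) * ln (real p))"
    by (simp add: sum_distrib_left sum_subtractf[symmetric] algebra_simps)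
  also have "\<dots> \<le> (\<Sum>p\<in>?P. real (multiplicity p (fact n :: nat)) * ln (real p))"
  proof (intro sum_mono mult_right_mono)
    fix p assume "p \<in> ?P"
    then have p: "prime p" by simp
    have "real n / real p - 1 \<le> real (n div p)"
      using floor_correct[of "real n / real p"] by (simp add: floor_divide_of_nat_eq)
    also have "\<dots> \<le> real (multiplicity p (fact n :: nat))"
      using multiplicity_fact_rec[OF p, of n] by simp
    finally show "real n / real p - 1 \<le> real (multiplicity p (fact n :: nat))" .
    show "0 \<le> ln (real p)" using prime_ge_1_nat[OF p] by simp
  qed
  also have "\<dots> = ln (fact n)" by (rule ln_fact_eq_sum_multiplicity[symmetric])
  also have "\<dots> \<le> ln (real n ^ n)"
    using fact_le_power[of n, where 'a = real] assms by (intro ln_mono) auto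
  also have "\<dots> = real n * ln (real n)" using assms by (simp add: ln_realpow)
  finally have "real n * (\<Sum>p\<in>?P. ln (real p) / real p) \<le> real n * (ln (real n) + ln 4)"
    using sum_ln_primes_le[of n] by (simp add: algebra_simps)
  then show ?thesis using assms by simp
qed

text \<open>The discrete counterpart of \<open>ln (ln x)\<close> having derivative \<open>1 / (x ln x)\<close>, which makes the main term of the
  Abel summation telescope; it is \<open>ln y \<le> y - 1\<close> at \<open>y = ln n / ln (n + 1)\<close>.\<close>

lemma ln_ln_Suc_diff_ge:
  assumes "n \<ge> (2::nat)"
  shows "1 - ln (real n) / ln (real (Suc n)) \<le> ln (ln (real (Suc n))) - ln (ln (real n))"
proof -
  have pos: "ln (real n) > 0" "ln (real (Suc n)) > 0" using assms by auto
  have "ln (ln (real n) / ln (real (Suc n))) \<le> ln (real n) / ln (real (Suc n)) - 1"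
    using pos by (intro ln_le_minus_one) simp
  then show ?thesis using pos by (simp add: ln_div)
qed

text \<open>Abel summation for \<open>1 / p = (ln p / p) \<sqdot> (1 / ln p)\<close>, carried out as an induction on \<open>n\<close>. Writing \<open>A\<close> for the
  sum of \<open>ln p / p\<close>, the step from \<open>n\<close> to \<open>n + 1\<close> amounts to
  \<open>(A - ln 4) (1 / ln n - 1 / ln (n + 1)) \<le> ln (ln (n + 1)) - ln (ln n)\<close>, and \<open>A - ln 4 \<le> ln n\<close> by Mertens'
  first theorem. The other terms on the right are chosen so that they telescope and so that equality holds at
  \<open>n = 2\<close>.\<close>

lemma sum_inverse_primes_summation:
  assumes "n \<ge> (2::nat)"
  shows "(\<Sum>p | prime p \<and> p \<le> n. 1 / real p) \<le>
      (\<Sum>p | prime p \<and> p \<le> n. ln (real p) / real p) / ln (real n)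
      + ln (ln (real n)) - ln (ln 2) + ln 4 * (1 / ln 2 - 1 / ln (real n))"
  using assms
proof (induction n rule: dec_induct)
  case base
  have "{p. prime p \<and> p \<le> (2::nat)} = {2}" by (auto dest: prime_ge_2_nat)
  then show ?case by simp
next
  case (step n)
  define A where "A = (\<Sum>p | prime p \<and> p \<le> n. ln (real p) / real p)"
  define S where "S = (\<Sum>p | prime p \<and> p \<le> n. 1 / real p)"
  define u where "u = ln (real n)"
  define v where "v = ln (real (Suc n))"
  define e where "e = (if prime (Suc n) then 1 / real (Suc n) else 0)"
  have uv: "0 < u" "u \<le> v" "0 < v" using step.hyps by (auto simp: u_def v_def)
  have set: "{p. prime p \<and> p \<le> Suc n} =
      (if prime (Suc n) then insert (Suc n) {p. prime p \<and> p \<le> n} else {p. prime p \<and> p \<le> n})"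
    by (auto simp: le_Suc_eq)
  have S': "(\<Sum>p | prime p \<and> p \<le> Suc n. 1 / real p) = S + e"
    unfolding set S_def e_def by simp
  have A': "(\<Sum>p | prime p \<and> p \<le> Suc n. ln (real p) / real p) = A + e * v"
    unfolding set A_def e_def v_def by simp
  have IH: "S \<le> A / u + ln u - ln (ln 2) + ln 4 * (1 / ln 2 - 1 / u)"
    using step.IH unfolding S_def A_def u_def .
  have "A \<le> u + ln 4"
    unfolding A_def u_def using step.hyps by (intro sum_ln_over_primes_le) simp
  moreover have "1 / v \<le> 1 / u" using uv by (simp add: frac_le)
  ultimately have "(A - ln 4) * (1 / u - 1 / v) \<le> u * (1 / u - 1 / v)"
    by (intro mult_right_mono) auto
  also have "\<dots> = 1 - u / v" using uv by (simp add: field_simps)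
  also have "\<dots> \<le> ln v - ln u"
    unfolding u_def v_def by (rule ln_ln_Suc_diff_ge) (use step.hyps in simp)
  finally have "A / u - ln 4 / u + ln u \<le> A / v - ln 4 / v + ln v"
    by (simp add: algebra_simps)
  moreover have "(A + e * v) / v = A / v + e" using uv by (simp add: field_simps)
  ultimately have "S + e \<le> (A + e * v) / v + ln v - ln (ln 2) + ln 4 * (1 / ln 2 - 1 / v)"
    using IH by (simp add: right_diff_distrib)
  then show ?case unfolding S' A' unfolding v_def .
qed

text \<open>The constant arises as \<open>1 + 2 - ln (ln 2) \<le> 4\<close>, where the \<open>2\<close> is \<open>ln 4 / ln 2\<close>; the terms \<open>ln 4 / ln n\<close> cancel.\<close>

lemma sum_inverse_primes_le:
  assumes "n \<ge> (2::nat)"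
  shows "(\<Sum>p | prime p \<and> p \<le> n. 1 / real p) \<le> ln (ln (real n)) + 4"
proof -
  let ?A = "\<Sum>p | prime p \<and> p \<le> n. ln (real p) / real p"
  have pos: "ln (real n) > 0" using assms by simp
  have "?A / ln (real n) \<le> (ln (real n) + ln 4) / ln (real n)"
    using sum_ln_over_primes_le[of n] assms pos by (intro divide_right_mono) auto
  also have "\<dots> = 1 + ln 4 / ln (real n)" using pos by (simp add: field_simps)
  finally have 1: "?A / ln (real n) \<le> 1 + ln 4 / ln (real n)" .
  have "ln 4 = ln ((2::real) ^ 2)" by simp
  also have "\<dots> = 2 * ln 2" by (subst ln_realpow) auto
  finally have 2: "ln 4 * (1 / ln 2 - 1 / ln (real n)) = 2 - ln 4 / ln (real n)"
    by (simp add: right_diff_distrib)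
  have "ln (1 / 2) \<le> ln (ln (2::real))"
    using ln2_ge_two_thirds by (intro ln_mono) auto
  then have 3: "- ln (ln (2::real)) \<le> 1"
    using ln_2_less_1 by (simp add: ln_div)
  show ?thesis using sum_inverse_primes_summation[OF assms] 1 2 3 by linarith
qed

text \<open>Replacing \<open>1 / p\<close> by \<open>1 / (p - 1)\<close> costs at most \<open>1\<close>, since the differences, summed over all integers
  from \<open>2\<close> on, telescope.\<close>

lemma sum_inverse_pred_primes_le:
  assumes "n \<ge> (2::nat)"
  shows "(\<Sum>p | prime p \<and> p \<le> n. 1 / (real p - 1)) \<le> ln (ln (real n)) + 5"
proof -
  let ?P = "{p. prime p \<and> p \<le> n}"
  have "(\<Sum>p\<in>?P. 1 / (real p - 1)) = (\<Sum>p\<in>?P. 1 / real p + (1 / (real p - 1) - 1 / real p))"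
    by simp
  also have "\<dots> = (\<Sum>p\<in>?P. 1 / real p) + (\<Sum>p\<in>?P. 1 / (real p - 1) - 1 / real p)"
    by (rule sum.distrib)
  also have "(\<Sum>p\<in>?P. 1 / (real p - 1) - 1 / real p) \<le> (\<Sum>k\<in>{2..n}. 1 / (real k - 1) - 1 / real k)"
    by (intro sum_mono2) (auto dest: prime_ge_2_nat intro!: frac_le)
  also have "(\<Sum>k\<in>{2..n}. 1 / (real k - 1) - 1 / real k) = 1 - 1 / real n"
    using assms by (induction n rule: dec_induct) auto
  also have "\<dots> \<le> 1" by simp
  also note sum_inverse_primes_le[OF assms]
  finally show ?thesis by simp
qed

section \<open>The constant and the final estimate\<close>

text \<open>If \<open>f\<close> is not integrable, then its integral is \<open>0\<close> by convention. The signs of the constants therefore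
  follow from the signs of the integrands, without a proof of convergence.\<close>

lemma integral_nonneg_total:
  fixes f :: "real \<Rightarrow> real"
  assumes "\<And>x. x \<in> S \<Longrightarrow> 0 \<le> f x"
  shows "0 \<le> integral S f"
  using assms by (cases "f integrable_on S") (auto simp: integral_nonneg not_integrable_integral)

lemma Re_Ei_nonneg: "0 \<le> Re (Ei (of_real a) (of_real z))"
proof (cases "(\<lambda>t::real. exp (- (of_real t * of_real z)) * of_real t powr (- of_real a) :: complex)
    integrable_on {1..}")
  case True
  let ?f = "\<lambda>t::real. exp (- (of_real t * of_real z)) * of_real t powr (- of_real a) :: complex"
  have "Re (Ei (of_real a) (of_real z)) = integral {1..} (Re \<circ> ?f)"
    unfolding Ei_def using integral_linear[OF True bounded_linear_Re] by simp
  also have "\<dots> \<ge> 0"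
  proof (rule integral_nonneg_total)
    fix t :: real assume "t \<in> {1..}"
    then have "?f t = of_real (exp (- (t * z)) * t powr (- a))"
      by (simp add: powr_of_real[symmetric] exp_of_real[symmetric])
    then show "0 \<le> (Re \<circ> ?f) t" by simp
  qed
  finally show ?thesis .
next
  case False
  then show ?thesis unfolding Ei_def by (simp add: not_integrable_integral)
qed

lemma c\<^sub>2_nonneg: "0 \<le> c\<^sub>2"
  unfolding c\<^sub>2_def
proof (rule integral_nonneg_total)
  fix x :: real assume x: "x \<in> {2..exp 1 + 1}"
  then have "0 \<le> x^3" "0 \<le> x^2" "2 \<le> x" by auto
  then have "0 \<le> 1200 * x^3 + 365 * x^2 + 9944 * x - 1993" by linarith
  then show "0 \<le> (1200 * x^3 + 365 * x^2 + 9944 * x - 1993) / (1200 * (x - 1)^4 * ln x)"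
    using x by (intro divide_nonneg_nonneg) auto
qed

text \<open>After clearing the denominator each term can be bounded separately: the rough bounds
  \<open>2/3 \<le> ln 2 \<le> 25/36\<close> are sharp enough, as the true value is about \<open>7.42\<close>.\<close>

lemma c\<^sub>1_ge: "6 \<le> c\<^sub>1"
proof -
  define L where "L = ln (2::real)"
  have L: "2/3 \<le> L" "L \<le> 25/36"
    unfolding L_def by (rule ln2_ge_two_thirds, rule ln2_le_25_over_36)
  have "L^2 \<le> (25/36)^2" "L^3 \<le> (25/36)^3" using L by (auto intro!: power_mono)
  then have "6 * (600 * L^3) \<le> - 5937 * L^2 + 3965 * L + 1586"
    using L by (simp add: power_divide)
  then show ?thesis
    unfolding c\<^sub>1_def L_def[symmetric] using L by (subst pos_le_divide_eq) auto
qed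

lemma c\<^sub>4_ge: "6 \<le> c\<^sub>4"
  using c\<^sub>1_ge c\<^sub>2_nonneg Re_Ei_nonneg[of 1 1] Re_Ei_nonneg[of 1 2] Re_Ei_nonneg[of 1 3]
  unfolding c\<^sub>4_def c\<^sub>3_def by simp

lemma Upsilon_le:
  assumes "n \<ge> (2::nat)"
  shows "real (Upsilon n) \<le> (real n - 1) * (ln (ln (real n)) + 5)"
proof -
  have "real (Upsilon n) = (\<Sum>p | prime p \<and> p \<le> n. real (multiplicity p (fact n :: nat)))"
    unfolding Upsilon_def by simp
  also have "\<dots> \<le> (\<Sum>p | prime p \<and> p \<le> n. (real n - 1) * (1 / (real p - 1)))"
  proof (rule sum_mono)
    fix p assume "p \<in> {p. prime p \<and> p \<le> n}"
    then have p: "prime p" "p > 1" by (auto dest: prime_gt_1_nat)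
    have "real ((p - 1) * multiplicity p (fact n :: nat)) \<le> real (n - 1)"
      using multiplicity_fact_upper[OF p(1), of n] assms by (intro of_nat_mono) auto
    then have "(real p - 1) * real (multiplicity p (fact n :: nat)) \<le> real n - 1"
      using p assms by (simp add: of_nat_diff)
    then show "real (multiplicity p (fact n :: nat)) \<le> (real n - 1) * (1 / (real p - 1))"
      using p by (simp add: field_simps)
  qed
  also have "\<dots> = (real n - 1) * (\<Sum>p | prime p \<and> p \<le> n. 1 / (real p - 1))"
    by (rule sum_distrib_left[symmetric])
  also have "\<dots> \<le> (real n - 1) * (ln (ln (real n)) + 5)"
    using sum_inverse_pred_primes_le[OF assms] assms by (intro mult_left_mono) auto
  finally show ?thesis .
qed

text \<open>For \<open>n \<ge> 3\<close> this says \<open>ln n \<le> e ln (n - 1)\<close>, and in fact \<open>ln n \<le> 2 ln (n - 1)\<close>. For \<open>n = 2\<close> the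
  right-hand side is \<open>1\<close> because \<open>ln 0 = 0\<close> by convention.\<close>

lemma ln_ln_le_pred:
  assumes "n \<ge> (2::nat)"
  shows "ln (ln (real n)) \<le> ln (ln (real n - 1)) + 1"
proof (cases "n = 2")
  case True
  have "ln (ln (2::real)) \<le> ln 2 - 1" by (intro ln_le_minus_one) simp
  then have "ln (ln (2::real)) \<le> 1" using ln_2_less_1 by linarith
  then show ?thesis using True by simp
next
  case False
  with assms have n: "real n - 1 \<ge> 2" by simp
  let ?a = "ln (real n - 1)" and ?b = "ln (real n)"
  have "ln 2 \<le> ?a" using n by (intro ln_mono) auto
  then have a: "?a \<ge> 1/2" using ln2_ge_two_thirds by linarith
  have b: "?b > 0" using n by simp
  have "?b - ?a = ln (real n / (real n - 1))" using n by (simp add: ln_div)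
  also have "\<dots> \<le> real n / (real n - 1) - 1" using n by (intro ln_le_minus_one) simp
  also have "\<dots> \<le> 1/2" using n by (simp add: field_simps)
  finally have "?b \<le> 2 * ?a" using a by simp
  then have "?b / ?a - 1 \<le> 1" using a by (simp add: field_simps)
  moreover have "ln (?b / ?a) \<le> ?b / ?a - 1" using a b by (intro ln_le_minus_one) simp
  ultimately show ?thesis using a b by (simp add: ln_div)
qed

theorem theorem1p1:
  fixes n :: nat
  assumes "n \<ge> 2"
  shows "real (Upsilon n) <
    (real n - 1) * ln (ln (real n - 1)) + c\<^sub>4 * (real n - 1)
      + real n / ln (real n) + 1717433 * real n / (ln (real n))^5"
proof -
  have "real (Upsilon n) \<le> (real n - 1) * (ln (ln (real n)) + 5)"
    by (rule Upsilon_le[OF assms])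
  also have "\<dots> \<le> (real n - 1) * (ln (ln (real n - 1)) + c\<^sub>4)"
    using ln_ln_le_pred[OF assms] c\<^sub>4_ge assms by (intro mult_left_mono) auto
  also have "\<dots> = (real n - 1) * ln (ln (real n - 1)) + c\<^sub>4 * (real n - 1)"
    by (simp add: algebra_simps)
  finally have "real (Upsilon n) \<le> (real n - 1) * ln (ln (real n - 1)) + c\<^sub>4 * (real n - 1)" .
  moreover have "real n / ln (real n) > 0" "1717433 * real n / (ln (real n))^5 > 0"
    using assms by auto
  ultimately show ?thesis by linarith
qed

end
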